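(* Let $S_n$ be the star graph with $n\ge 1$ vertices. (i) If both players play optimally, the first player wins $MS(S_n)$ with probability $\frac{n-1}{n}$, and guessing the root is an optimal first guess. (ii) If the exploitative player $X$ plays against the random player $R$, then $P(S_n)=\frac{n-1}{n}$, achieved by guessing the root. (iii) For $n\ge 4$, $Q(S_n)=\frac{n^2-2n+2}{n^2}$. (iv) $\lim_{n\to\infty}P(S_n)=\lim_{n\to\infty}Q(S_n)=1$.
   Context: The misère tree search game $MS(T)$ is played by two players on a finite tree $T$. One vertex of $T$, chosen uniformly at random and unknown to both players, is poisoned. The players alternately guess a vertex of the current tree. If a player guesses the poisoned vertex, that player loses (and the other wins). Otherwise the guessed vertex is deleted from the current tree, it is revealed which of the resulting connected components contains the poisoned vertex, and the game continues on that component with the other player to move. (A player facing a one-vertex tree must guess it and loses.) The random player $R$ makes every guess uniformly at random among the vertices of the current tree. The exploitative player $X$ knows this and plays so as to maximise the probability of winning against $R$. $P(T)$ and $Q(T)$ denote the probability that $X$ wins $MS(T)$ against $R$ when $X$ is the first player and the second player respectively. The star $S_n$ is the tree with one root vertex and $n-1$ leaves, each adjacent to the root. *)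

theory Defs
  imports "HOL-Probability.Probability"
begin

text \<open>
  A simple graph is a vertex set with a symmetric, irreflexive adjacency relation.  The trees that
  occur during a play are induced subgraphs of the initial tree, so they are represented by their
  vertex sets.
\<close>

record 'a graph =
  verts :: "'a set"
  edges :: "('a \<times> 'a) set"

definition component :: "('a \<times> 'a) set \<Rightarrow> 'a set \<Rightarrow> 'a \<Rightarrow> 'a set" where
  "component E C p = {u \<in> C. (p, u) \<in> (Restr E C)\<^sup>*}"

text \<open>
  A strategy may randomise, and may depend on the list of all earlier guesses (of both players,
  oldest first) and on the vertex set of the current tree.  This is everything a player has
  observed: the trees met earlier in the play can be recovered from these data.
\<close>

type_synonym 'a strategy = "'a list \<Rightarrow> 'a set \<Rightarrow> 'a pmf"

definition strategies :: "'a graph \<Rightarrow> 'a strategy set" where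
  "strategies T = {\<sigma>. \<forall>h C. C \<noteq> {} \<and> C \<subseteq> verts T \<longrightarrow> set_pmf (\<sigma> h C) \<subseteq> C}"

definition random_player :: "'a strategy" where
  "random_player h C = pmf_of_set C"

text \<open>
  \<open>play E p h C \<sigma> \<tau>\<close> is the distribution of the event that the player to move wins, where
  \<open>p\<close> is the poisoned vertex, \<open>h\<close> the earlier guesses, \<open>C\<close> the current tree, \<open>\<sigma>\<close> the strategy
  of the player to move and \<open>\<tau>\<close> that of the opponent.  The conditions \<open>infinite C\<close> and
  \<open>v \<notin> C\<close> only make the function total; they never hold when strategies from
  \<open>strategies\<close> are played on a finite tree.
\<close>

function play ::
  "('a \<times> 'a) set \<Rightarrow> 'a \<Rightarrow> 'a list \<Rightarrow> 'a set \<Rightarrow> 'a strategy \<Rightarrow> 'a strategy \<Rightarrow> bool pmf" where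
  "play E p h C \<sigma> \<tau> =
     (if infinite C then return_pmf False
      else bind_pmf (\<sigma> h C) (\<lambda>v.
        if v \<notin> C \<or> v = p then return_pmf False
        else map_pmf Not (play E p (h @ [v]) (component E (C - {v}) p) \<tau> \<sigma>)))"
  by pat_completeness auto
termination
proof (relation "Wellfounded.measure (\<lambda>(E, p, h, C, \<sigma>, \<tau>). card C)", goal_cases)
  case 1
  show ?case by simp
next
  case (2 E p h C \<sigma> \<tau> v)
  then have "component E (C - {v}) p \<subset> C"
    by (auto simp: component_def)
  with 2 show ?case
    by (auto intro: psubset_card_mono)
qed

declare play.simps [simp del]

text \<open>The value \<open>True\<close> of the game means that the first player wins.\<close>

definition MS :: "'a graph \<Rightarrow> 'a strategy \<Rightarrow> 'a strategy \<Rightarrow> bool pmf" where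
  "MS T \<sigma> \<tau> = bind_pmf (pmf_of_set (verts T)) (\<lambda>p. play (edges T) p [] (verts T) \<sigma> \<tau>)"

definition first_wins :: "'a graph \<Rightarrow> 'a strategy \<Rightarrow> 'a strategy \<Rightarrow> real" where
  "first_wins T \<sigma> \<tau> = pmf (MS T \<sigma> \<tau>) True"

definition second_wins :: "'a graph \<Rightarrow> 'a strategy \<Rightarrow> 'a strategy \<Rightarrow> real" where
  "second_wins T \<sigma> \<tau> = pmf (MS T \<sigma> \<tau>) False"

text \<open>
  Optimal play in this zero-sum game: a strategy is optimal if it maximises the winning
  probability that it guarantees against every strategy of the opponent.
\<close>

definition optimal_first :: "'a graph \<Rightarrow> 'a strategy \<Rightarrow> bool" where
  "optimal_first T \<sigma> \<longleftrightarrow> \<sigma> \<in> strategies T \<and>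
     (\<forall>\<sigma>' \<in> strategies T.
        (INF \<tau> \<in> strategies T. first_wins T \<sigma>' \<tau>) \<le> (INF \<tau> \<in> strategies T. first_wins T \<sigma> \<tau>))"

definition optimal_second :: "'a graph \<Rightarrow> 'a strategy \<Rightarrow> bool" where
  "optimal_second T \<tau> \<longleftrightarrow> \<tau> \<in> strategies T \<and>
     (\<forall>\<tau>' \<in> strategies T.
        (INF \<sigma> \<in> strategies T. second_wins T \<sigma> \<tau>') \<le> (INF \<sigma> \<in> strategies T. second_wins T \<sigma> \<tau>))"

definition P :: "'a graph \<Rightarrow> real" where
  "P T = (SUP \<sigma> \<in> strategies T. first_wins T \<sigma> random_player)"

definition Q :: "'a graph \<Rightarrow> real" where
  "Q T = (SUP \<tau> \<in> strategies T. second_wins T random_player \<tau>)"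

text \<open>The star has root \<open>0\<close> and leaves \<open>1, \<dots>, n - 1\<close>.\<close>

definition star :: "nat \<Rightarrow> nat graph" where
  "star n = \<lparr>verts = {0..<n}, edges = {0} \<times> {1..<n} \<union> {1..<n} \<times> {0}\<rparr>"

end

theory Submission
  imports Defs "HOL-Real_Asymp.Real_Asymp"
begin

text \<open>
  A first guess is made without any knowledge of the poison, so on a tree with \<open>m\<close> vertices it
  hits the poison with probability exactly \<open>1 / m\<close>, whatever the strategy.  Hence the player to
  move never wins with probability above \<open>(m - 1) / m\<close>, against any opponent
  (\<open>sum_play_True_le\<close>).  On a star this bound is attained: a wrong guess at the root isolates
  the poisoned leaf, and the opponent has to guess it (\<open>sum_play_True_root\<close>).  So the value of
  the game, and the best result of a first player against the random player, are both
  \<open>(n - 1) / n\<close>; moreover every strategy of the second player guarantees exactly \<open>1 / n\<close>,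
  and all of them are optimal.

  When the random player begins, there are \<open>n\<^sup>2\<close> equally likely pairs of a poison \<open>p\<close> and a first
  guess \<open>v\<close>.  For \<open>v = 0\<close> the random player wins with each of the \<open>n - 1\<close> poisons \<open>p \<noteq> 0\<close>.
  For each of the \<open>n - 1\<close> leaves \<open>v\<close>, the opponent is to move on a star with \<open>n - 1\<close> vertices and
  uniform poison; summed over \<open>p \<noteq> v\<close>, the random player's winning probabilities are then
  at least \<open>1\<close>, with equality if the opponent guesses the root.  So the random player wins with
  probability at least \<open>2 (n - 1) / n\<^sup>2\<close>, and no more against the root strategy.
\<close>

lemma play_True:
  assumes "finite C" "set_pmf (\<sigma> h C) \<subseteq> C"
  shows "pmf (play E p h C \<sigma> \<tau>) True =
    (\<Sum>v\<in>C - {p}. pmf (\<sigma> h C) v *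
       pmf (play E p (h @ [v]) (component E (C - {v}) p) \<tau> \<sigma>) False)"
proof -
  have Not: "pmf (map_pmf Not M) True = pmf M False" for M
    using pmf_map_inj'[of Not M False] by (simp add: inj_def)
  have "pmf (play E p h C \<sigma> \<tau>) True =
    (\<Sum>v\<in>C. pmf (if v \<notin> C \<or> v = p then return_pmf False
        else map_pmf Not (play E p (h @ [v]) (component E (C - {v}) p) \<tau> \<sigma>)) True
      * pmf (\<sigma> h C) v)"
    using assms
    by (subst play.simps) (simp add: pmf_bind, subst integral_measure_pmf_real[of C], auto)
  also have "\<dots> = (\<Sum>v\<in>C - {p}. pmf (\<sigma> h C) v *
       pmf (play E p (h @ [v]) (component E (C - {v}) p) \<tau> \<sigma>) False)"
    using assms(1) by (intro sum.mono_neutral_cong_right) (auto simp: Not)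
  finally show ?thesis .
qed

text \<open>
  Summing over \<open>p\<close> expresses the uniform choice of the poison in the current tree.  The
  probabilities \<open>pmf (\<sigma> h C) p\<close> of an immediate loss do not depend on the poison
  otherwise, so they add up to \<open>1\<close>.
\<close>

lemma sum_play_True_le:
  assumes "finite C" "set_pmf (\<sigma> h C) \<subseteq> C"
  shows "(\<Sum>p\<in>C. pmf (play E p h C \<sigma> \<tau>) True) \<le> real (card C) - 1"
proof -
  have total: "(\<Sum>v\<in>C. pmf (\<sigma> h C) v) = 1"
    by (rule sum_pmf_eq_1[OF assms])
  have "pmf (play E p h C \<sigma> \<tau>) True \<le> 1 - pmf (\<sigma> h C) p" if "p \<in> C" for p
  proof -
    have "pmf (play E p h C \<sigma> \<tau>) True \<le> (\<Sum>v\<in>C - {p}. pmf (\<sigma> h C) v)"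
      unfolding play_True[of C \<sigma> h, OF assms]
      by (intro sum_mono mult_left_le) (auto simp: pmf_le_1)
    also have "\<dots> = 1 - pmf (\<sigma> h C) p"
      using total sum.remove[OF assms(1) that, of "pmf (\<sigma> h C)"] by simp
    finally show ?thesis .
  qed
  then have "(\<Sum>p\<in>C. pmf (play E p h C \<sigma> \<tau>) True) \<le> (\<Sum>p\<in>C. 1 - pmf (\<sigma> h C) p)"
    by (rule sum_mono)
  also have "\<dots> = real (card C) - 1"
    using total by (simp add: sum_subtractf)
  finally show ?thesis .
qed

lemma play_singleton:
  assumes "set_pmf (\<sigma> h {p}) \<subseteq> {p}"
  shows "pmf (play E p h {p} \<sigma> \<tau>) True = 0"
  using assms by (subst play_True) auto

lemma component_star_leaves:
  assumes "0 \<notin> C" "p \<in> C"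
  shows "component (edges (star n)) C p = {p}"
proof -
  have "Restr (edges (star n)) C = {}"
    using assms(1) by (auto simp: star_def)
  then show ?thesis
    using assms(2) by (auto simp: component_def)
qed

lemma component_star_root:
  assumes "0 \<in> C" "C \<subseteq> {0..<n}" "p \<in> C"
  shows "component (edges (star n)) C p = C"
proof -
  let ?R = "Restr (edges (star n)) C"
  have "(p, 0) \<in> ?R\<^sup>*"
    using assms by (cases "p = 0") (auto simp: star_def intro!: r_into_rtrancl)
  moreover have "(0, u) \<in> ?R\<^sup>*" if "u \<in> C" for u
    using assms that by (cases "u = 0") (auto simp: star_def intro!: r_into_rtrancl)
  ultimately show ?thesis
    by (auto simp: component_def intro: rtrancl_trans)
qed

lemma play_star_root_guessed:
  assumes "finite C" "\<tau> (h @ [0]) {p} = return_pmf p" "\<sigma> h C = return_pmf 0" "0 \<in> C" "p \<in> C"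
  shows "pmf (play (edges (star n)) p h C \<sigma> \<tau>) True = (if p = 0 then 0 else 1)"
proof (cases "p = 0")
  case False
  have "pmf (play (edges (star n)) p h C \<sigma> \<tau>) True =
    (\<Sum>v\<in>{0}. pmf (\<sigma> h C) v *
       pmf (play (edges (star n)) p (h @ [v]) (component (edges (star n)) (C - {v}) p) \<tau> \<sigma>) False)"
    using assms(1,3-5) False
    by (subst play_True, simp, simp, intro sum.mono_neutral_right) auto
  also have "\<dots> = 1"
    using assms False component_star_leaves[of "C - {0}" p n] play_singleton[of \<tau> "h @ [0]" p]
    by (simp add: pmf_False_conv_True)
  finally show ?thesis
    using False by simp
next
  case True
  then show ?thesis
    using assms by (subst play_True) (auto intro!: sum.neutral simp: pmf_return)
qed

lemma strategies_support:
  assumes "\<sigma> \<in> strategies T" "C \<noteq> {}" "C \<subseteq> verts T"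
  shows "set_pmf (\<sigma> h C) \<subseteq> C"
  using assms by (simp add: strategies_def)

lemma strategy_singleton:
  assumes "\<tau> \<in> strategies T" "p \<in> verts T"
  shows "\<tau> h {p} = return_pmf p"
  using strategies_support[OF assms(1), of "{p}"] assms(2)
  by (simp add: set_pmf_subset_singleton)

lemma sum_play_True_root:
  assumes "\<tau> \<in> strategies (star n)" "\<sigma> h C = return_pmf 0" "0 \<in> C" "C \<subseteq> {0..<n}"
  shows "(\<Sum>p\<in>C. pmf (play (edges (star n)) p h C \<sigma> \<tau>) True) = real (card C) - 1"
proof -
  have fin: "finite C"
    using assms(4) finite_subset by blast
  have "(\<Sum>p\<in>C. pmf (play (edges (star n)) p h C \<sigma> \<tau>) True) = (\<Sum>p\<in>C. if p = 0 then 0 else 1)"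
    using assms fin
    by (intro sum.cong refl play_star_root_guessed strategy_singleton[OF assms(1)])
       (auto simp: star_def)
  also have "\<dots> = (\<Sum>p\<in>C - {0}. 1)"
    using fin by (intro sum.mono_neutral_cong_right) auto
  also have "\<dots> = real (card C) - 1"
    using fin assms(3) card_Suc_Diff1[OF fin assms(3)] by simp
  finally show ?thesis .
qed

lemma random_player_strategy:
  assumes "finite (verts T)"
  shows "random_player \<in> strategies T"
  using finite_subset[OF _ assms] by (auto simp: strategies_def random_player_def)

text \<open>
  Where the root is already gone, the choice is immaterial: on a star the poisoned component is
  then a single vertex.
\<close>

definition root_strategy :: "nat strategy" where
  "root_strategy h C = (if 0 \<in> C then return_pmf 0 else pmf_of_set C)"

lemma root_strategy_strategy:
  assumes "finite (verts T)"
  shows "root_strategy \<in> strategies T"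
  using finite_subset[OF _ assms] by (auto simp: strategies_def root_strategy_def)

lemma verts_star [simp]: "verts (star n) = {0..<n}"
  by (simp add: star_def)

lemma first_wins_eq_sum:
  assumes "finite (verts T)" "verts T \<noteq> {}"
  shows "first_wins T \<sigma> \<tau> =
    (\<Sum>p\<in>verts T. pmf (play (edges T) p [] (verts T) \<sigma> \<tau>) True) / real (card (verts T))"
  using assms by (simp add: first_wins_def MS_def pmf_bind_pmf_of_set)

lemma second_wins_eq: "second_wins T \<sigma> \<tau> = 1 - first_wins T \<sigma> \<tau>"
  by (simp add: second_wins_def first_wins_def pmf_False_conv_True)

lemma first_wins_le:
  assumes "finite (verts T)" "verts T \<noteq> {}" "\<sigma> \<in> strategies T"
  shows "first_wins T \<sigma> \<tau> \<le> (real (card (verts T)) - 1) / real (card (verts T))"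
proof -
  have "set_pmf (\<sigma> [] (verts T)) \<subseteq> verts T"
    using assms by (intro strategies_support) auto
  then show ?thesis
    using assms by (simp add: first_wins_eq_sum divide_right_mono sum_play_True_le)
qed

lemma first_wins_star_le:
  assumes "n \<ge> 1" "\<sigma> \<in> strategies (star n)"
  shows "first_wins (star n) \<sigma> \<tau> \<le> (real n - 1) / real n"
  using first_wins_le[of "star n" \<sigma> \<tau>] assms by (simp add: star_def)

lemma first_wins_star_root:
  assumes "n \<ge> 1" "\<tau> \<in> strategies (star n)"
  shows "first_wins (star n) root_strategy \<tau> = (real n - 1) / real n"
  using assms sum_play_True_root[of \<tau> n root_strategy "[]" "{0..<n}"]
  by (subst first_wins_eq_sum) (simp_all add: star_def root_strategy_def)

lemma optimal_first_root_strategy: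
  assumes n: "n \<ge> 1"
  shows "optimal_first (star n) root_strategy"
    and "(INF \<tau> \<in> strategies (star n). first_wins (star n) root_strategy \<tau>) = (real n - 1) / real n"
proof -
  let ?S = "strategies (star n)"
  have R: "random_player \<in> ?S"
    by (simp add: random_player_strategy)
  show inf: "(INF \<tau> \<in> ?S. first_wins (star n) root_strategy \<tau>) = (real n - 1) / real n"
    using R first_wins_star_root[OF n] by (subst INF_cong[OF refl]) (auto intro!: cINF_const)
  have "(INF \<tau> \<in> ?S. first_wins (star n) \<sigma> \<tau>) \<le> (real n - 1) / real n" if "\<sigma> \<in> ?S" for \<sigma>
    using R first_wins_star_le[OF n that]
    by (intro cINF_lower2[OF _ R]) (auto intro!: bdd_belowI2[of _ 0] simp: first_wins_def)
  then show "optimal_first (star n) root_strategy"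
    by (simp add: optimal_first_def inf root_strategy_strategy)
qed

lemma first_wins_optimal:
  assumes n: "n \<ge> 1" and opt: "optimal_first (star n) \<sigma>" and \<tau>: "\<tau> \<in> strategies (star n)"
  shows "first_wins (star n) \<sigma> \<tau> = (real n - 1) / real n"
proof (rule antisym)
  show "first_wins (star n) \<sigma> \<tau> \<le> (real n - 1) / real n"
    using n opt by (simp add: optimal_first_def first_wins_star_le)
  have "(real n - 1) / real n \<le> (INF \<tau> \<in> strategies (star n). first_wins (star n) \<sigma> \<tau>)"
    using opt optimal_first_root_strategy(2)[OF n] root_strategy_strategy[of "star n"]
    by (force simp: optimal_first_def)
  also have "\<dots> \<le> first_wins (star n) \<sigma> \<tau>"
    using \<tau> by (intro cINF_lower) (auto intro!: bdd_belowI2[of _ 0] simp: first_wins_def)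
  finally show "(real n - 1) / real n \<le> first_wins (star n) \<sigma> \<tau>" .
qed

text \<open>
  The first player's bound \<open>(n - 1) / n\<close> holds against every opponent, so no second player is ever
  pushed below \<open>1 / n\<close>; the root strategy pushes each of them down to it.
\<close>

lemma optimal_second_star:
  assumes n: "n \<ge> 1" and \<tau>: "\<tau> \<in> strategies (star n)"
  shows "optimal_second (star n) \<tau>"
proof -
  let ?S = "strategies (star n)"
  have "(INF \<sigma> \<in> ?S. second_wins (star n) \<sigma> \<tau>') = 1 - (real n - 1) / real n" if "\<tau>' \<in> ?S" for \<tau>'
  proof (rule cInf_eq_minimum)
    show "1 - (real n - 1) / real n \<in> (\<lambda>\<sigma>. second_wins (star n) \<sigma> \<tau>') ` ?S"
      by (rule image_eqI[of _ _ root_strategy])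
         (simp_all add: second_wins_eq first_wins_star_root[OF n that] root_strategy_strategy)
  qed (use first_wins_star_le[OF n] in \<open>auto simp: second_wins_eq\<close>)
  then show ?thesis
    using \<tau> by (simp add: optimal_second_def)
qed

lemma P_star:
  assumes n: "n \<ge> 1"
  shows "P (star n) = (real n - 1) / real n"
  unfolding P_def
proof (rule cSup_eq_maximum)
  show "(real n - 1) / real n \<in> (\<lambda>\<sigma>. first_wins (star n) \<sigma> random_player) ` strategies (star n)"
    by (rule image_eqI[of _ _ root_strategy])
       (simp_all add: first_wins_star_root[OF n] random_player_strategy root_strategy_strategy)
qed (use first_wins_star_le[OF n] in auto)

text \<open>
  The summand \<open>n - 1\<close> comes from the root as first guess.  In the double sum over the other first
  guesses \<open>v\<close>, the inner sum is the opponent's total over the poisons of the star that remains, to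
  which the two lemmas on \<open>\<Sum>p\<in>C. pmf (play E p h C \<sigma> \<tau>) True\<close> apply.
\<close>

lemma first_wins_random_star:
  assumes n: "n \<ge> 1" and \<tau>: "\<tau> \<in> strategies (star n)"
  shows "first_wins (star n) random_player \<tau> =
    ((real n - 1) + (\<Sum>v\<in>{1..<n}. (real n - 1) -
       (\<Sum>p\<in>{0..<n} - {v}. pmf (play (edges (star n)) p [v] ({0..<n} - {v}) \<tau> random_player) True)))
     / (real n)\<^sup>2"
proof -
  let ?V = "{0..<n}" and ?E = "edges (star n)"
  define L where "L p v = pmf (play ?E p [v] (component ?E (?V - {v}) p) \<tau> random_player) False"
    for p v
  have "pmf (play ?E p [] ?V random_player \<tau>) True = (\<Sum>v\<in>?V - {p}. L p v) / real n" for p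
    using n by (subst play_True) (auto simp: random_player_def L_def sum_divide_distrib)
  then have fw: "first_wins (star n) random_player \<tau> =
      (\<Sum>p\<in>?V. (\<Sum>v\<in>?V - {p}. L p v) / real n) / real n"
    using n by (subst first_wins_eq_sum) (simp_all add: star_def)
  also have "\<dots> = (\<Sum>p\<in>?V. \<Sum>v\<in>?V - {p}. L p v) / (real n)\<^sup>2"
    by (simp add: sum_divide_distrib[symmetric] power2_eq_square)
  also have "(\<Sum>p\<in>?V. \<Sum>v\<in>?V - {p}. L p v) = (\<Sum>v\<in>?V. \<Sum>p\<in>?V - {v}. L p v)"
  proof -
    have "(\<Sum>p\<in>?V. \<Sum>v\<in>?V - {p}. L p v) = (\<Sum>p\<in>?V. \<Sum>v | v \<in> ?V \<and> p \<noteq> v. L p v)"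
      by (intro sum.cong) auto
    also have "\<dots> = (\<Sum>v\<in>?V. \<Sum>p | p \<in> ?V \<and> p \<noteq> v. L p v)"
      by (rule sum.swap_restrict) auto
    also have "\<dots> = (\<Sum>v\<in>?V. \<Sum>p\<in>?V - {v}. L p v)"
      by (intro sum.cong) auto
    finally show ?thesis .
  qed
  also have "\<dots> = (\<Sum>p\<in>?V - {0}. L p 0) + (\<Sum>v\<in>{1..<n}. \<Sum>p\<in>?V - {v}. L p v)"
    using n by (simp add: sum.atLeast_Suc_lessThan)
  also have "(\<Sum>p\<in>?V - {0}. L p 0) = real n - 1"
  proof -
    have "L p 0 = 1" if "p \<in> ?V - {0}" for p
      using that strategy_singleton[OF \<tau>, of p "[0]"] play_singleton[of \<tau> "[0]" p]
      by (simp add: L_def component_star_leaves pmf_False_conv_True)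
    then show ?thesis
      using n by (simp add: of_nat_diff)
  qed
  also have "(\<Sum>v\<in>{1..<n}. \<Sum>p\<in>?V - {v}. L p v) = (\<Sum>v\<in>{1..<n}. (real n - 1) -
       (\<Sum>p\<in>?V - {v}. pmf (play ?E p [v] (?V - {v}) \<tau> random_player) True))"
  proof (rule sum.cong[OF refl])
    fix v assume v: "v \<in> {1..<n}"
    have "L p v = 1 - pmf (play ?E p [v] (?V - {v}) \<tau> random_player) True" if "p \<in> ?V - {v}" for p
      using that v component_star_root[of "?V - {v}" n p]
      by (simp add: L_def pmf_False_conv_True)
    then show "(\<Sum>p\<in>?V - {v}. L p v) = (real n - 1) -
       (\<Sum>p\<in>?V - {v}. pmf (play ?E p [v] (?V - {v}) \<tau> random_player) True)"
      using n v by (simp add: sum_subtractf of_nat_diff)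
  qed
  finally show ?thesis .
qed

lemma first_wins_random_star_ge:
  assumes n: "n \<ge> 1" and \<tau>: "\<tau> \<in> strategies (star n)"
  shows "2 * (real n - 1) / (real n)\<^sup>2 \<le> first_wins (star n) random_player \<tau>"
proof -
  let ?V = "{0..<n}"
  let ?W = "\<lambda>v. \<Sum>p\<in>?V - {v}. pmf (play (edges (star n)) p [v] (?V - {v}) \<tau> random_player) True"
  have "1 \<le> (real n - 1) - ?W v" if v: "v \<in> {1..<n}" for v
  proof -
    have "0 \<in> ?V - {v}"
      using v by simp
    then have "?V - {v} \<noteq> {}"
      by blast
    then have "set_pmf (\<tau> [v] (?V - {v})) \<subseteq> ?V - {v}"
      by (intro strategies_support[OF \<tau>]) auto
    then show ?thesis
      using v sum_play_True_le[of "?V - {v}" \<tau> "[v]" "edges (star n)" random_player]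
      by (simp add: of_nat_diff)
  qed
  then have "(\<Sum>v\<in>{1..<n}. 1) \<le> (\<Sum>v\<in>{1..<n}. (real n - 1) - ?W v)"
    by (rule sum_mono)
  then show ?thesis
    unfolding first_wins_random_star[OF n \<tau>] using n
    by (intro divide_right_mono) (simp_all add: of_nat_diff)
qed

lemma first_wins_random_star_root:
  assumes n: "n \<ge> 1"
  shows "first_wins (star n) random_player root_strategy = 2 * (real n - 1) / (real n)\<^sup>2"
proof -
  let ?V = "{0..<n}"
  have "(\<Sum>p\<in>?V - {v}. pmf (play (edges (star n)) p [v] (?V - {v}) root_strategy random_player) True)
      = real n - 2" if v: "v \<in> {1..<n}" for v
    using v by (subst sum_play_True_root)
      (auto simp: random_player_strategy root_strategy_def of_nat_diff)
  then show ?thesis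
    using n by (subst first_wins_random_star) (simp_all add: root_strategy_strategy of_nat_diff)
qed

lemma Q_star:
  assumes n: "n \<ge> 1"
  shows "Q (star n) = (real n ^ 2 - 2 * real n + 2) / real n ^ 2"
proof -
  have "Q (star n) = 1 - 2 * (real n - 1) / (real n)\<^sup>2"
    unfolding Q_def
  proof (rule cSup_eq_maximum)
    show "1 - 2 * (real n - 1) / (real n)\<^sup>2
        \<in> (\<lambda>\<tau>. second_wins (star n) random_player \<tau>) ` strategies (star n)"
      by (rule image_eqI[of _ _ root_strategy])
         (simp_all add: second_wins_eq first_wins_random_star_root[OF n] root_strategy_strategy)
  qed (use first_wins_random_star_ge[OF n] in \<open>auto simp: second_wins_eq\<close>)
  also have "\<dots> = (real n ^ 2 - 2 * real n + 2) / real n ^ 2"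
    using n by (simp add: field_simps)
  finally show ?thesis .
qed

theorem mainTheorem4:
  shows
    "(\<forall>n::nat. n \<ge> 1 \<longrightarrow>
        (\<forall>\<sigma> \<tau>. optimal_first (star n) \<sigma> \<and> optimal_second (star n) \<tau> \<longrightarrow>
           first_wins (star n) \<sigma> \<tau> = (real n - 1) / real n)
        \<and> (\<exists>\<sigma>. optimal_first (star n) \<sigma> \<and> \<sigma> [] (verts (star n)) = return_pmf 0)
        \<and> (\<exists>\<tau>. optimal_second (star n) \<tau>))
     \<and> (\<forall>n::nat. n \<ge> 1 \<longrightarrow>
        P (star n) = (real n - 1) / real n
        \<and> (\<exists>\<sigma> \<in> strategies (star n). \<sigma> [] (verts (star n)) = return_pmf 0
             \<and> first_wins (star n) \<sigma> random_player = P (star n)))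
     \<and> (\<forall>n::nat. n \<ge> 4 \<longrightarrow>
        Q (star n) = (real n ^ 2 - 2 * real n + 2) / real n ^ 2)
     \<and> (\<lambda>n. P (star n)) \<longlonglongrightarrow> 1
     \<and> (\<lambda>n. Q (star n)) \<longlonglongrightarrow> 1"
proof (intro conjI allI impI; (elim conjE)?)
  fix n :: nat and \<sigma> \<tau> assume "n \<ge> 1" "optimal_first (star n) \<sigma>" "optimal_second (star n) \<tau>"
  then show "first_wins (star n) \<sigma> \<tau> = (real n - 1) / real n"
    by (simp add: first_wins_optimal optimal_second_def)
next
  fix n :: nat assume n: "n \<ge> 1"
  have root: "root_strategy [] (verts (star n)) = return_pmf 0"
    using n by (simp add: root_strategy_def star_def)
  show "\<exists>\<sigma>. optimal_first (star n) \<sigma> \<and> \<sigma> [] (verts (star n)) = return_pmf 0"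
    using optimal_first_root_strategy(1)[OF n] root by blast
  show "\<exists>\<tau>. optimal_second (star n) \<tau>"
    using optimal_second_star[OF n random_player_strategy] by auto
  show "P (star n) = (real n - 1) / real n"
    by (rule P_star[OF n])
  show "\<exists>\<sigma> \<in> strategies (star n). \<sigma> [] (verts (star n)) = return_pmf 0
      \<and> first_wins (star n) \<sigma> random_player = P (star n)"
    using root P_star[OF n] first_wins_star_root[OF n random_player_strategy]
    by (intro bexI[of _ root_strategy]) (simp_all add: root_strategy_strategy)
next
  fix n :: nat assume "n \<ge> 4"
  then show "Q (star n) = (real n ^ 2 - 2 * real n + 2) / real n ^ 2"
    by (simp add: Q_star)
next
  have "(\<lambda>n. (real n - 1) / real n) \<longlonglongrightarrow> 1"
    by real_asymp
  then show "(\<lambda>n. P (star n)) \<longlonglongrightarrow> 1"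
    by (rule Lim_transform_eventually) (auto intro!: eventually_sequentiallyI[of 1] simp: P_star)
  have "(\<lambda>n. (real n ^ 2 - 2 * real n + 2) / real n ^ 2) \<longlonglongrightarrow> 1"
    by real_asymp
  then show "(\<lambda>n. Q (star n)) \<longlonglongrightarrow> 1"
    by (rule Lim_transform_eventually) (auto intro!: eventually_sequentiallyI[of 1] simp: Q_star)
qed

end
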